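(* Let $G$ be a finite simple graph and let $\Lambda\subseteq\Omega(G)$ with $|\Lambda|\ge 1$. Then $$d\Big(\bigcup\Lambda\Big)=\Big|\bigcap\Lambda\Big|+\Big|\bigcup\Lambda\Big|-|V(G)|\ \ge\ \max_{S\in\Lambda} d(S).$$ In particular, $$d(\mathrm{corona}(G))=|\mathrm{corona}(G)|+|\mathrm{core}(G)|-|V(G)|\ \ge\ 2\alpha(G)-|V(G)|=\max_{S\in\Omega(G)} d(S).$$
   Context: For $X\subseteq V(G)$, $N(X)$ is the set of vertices adjacent to some vertex of $X$, and $d(X)=|X|-|N(X)|$. $\alpha(G)$ is the maximum cardinality of an independent set (a set of pairwise non-adjacent vertices), $\Omega(G)$ is the family of all maximum independent sets, $\mathrm{core}(G)=\bigcap\Omega(G)$ and $\mathrm{corona}(G)=\bigcup\Omega(G)$. For a family $\Lambda$ of sets, $\bigcup\Lambda$ and $\bigcap\Lambda$ denote the union and intersection of its members. *)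

theory Defs
  imports "Graph_Theory.Digraph"
begin

text \<open>Finite simple graphs are the library's \<^locale>\<open>graph\<close>: finite, loop-free, symmetric
  digraphs without parallel arcs. Adjacency of \<open>u\<close> and \<open>v\<close> is \<^term>\<open>u \<rightarrow>\<^bsub>G\<^esub> v\<close>.\<close>

definition nbhd :: "('a, 'b) pre_digraph \<Rightarrow> 'a set \<Rightarrow> 'a set" where
  "nbhd G X = {v \<in> verts G. \<exists>x \<in> X. x \<rightarrow>\<^bsub>G\<^esub> v}"

definition diff :: "('a, 'b) pre_digraph \<Rightarrow> 'a set \<Rightarrow> int" where
  "diff G X = int (card X) - int (card (nbhd G X))"

definition independent_set :: "('a, 'b) pre_digraph \<Rightarrow> 'a set \<Rightarrow> bool" where
  "independent_set G S \<longleftrightarrow> S \<subseteq> verts G \<and> (\<forall>u \<in> S. \<forall>v \<in> S. \<not> u \<rightarrow>\<^bsub>G\<^esub> v)"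

definition independence_number :: "('a, 'b) pre_digraph \<Rightarrow> nat" where
  "independence_number G = Max {card S | S. independent_set G S}"

definition max_independent_sets :: "('a, 'b) pre_digraph \<Rightarrow> 'a set set" where
  "max_independent_sets G = {S. independent_set G S \<and> card S = independence_number G}"

definition core :: "('a, 'b) pre_digraph \<Rightarrow> 'a set" where
  "core G = \<Inter> (max_independent_sets G)"

definition corona :: "('a, 'b) pre_digraph \<Rightarrow> 'a set" where
  "corona G = \<Union> (max_independent_sets G)"

end

theory Submission
  imports Defs
begin

text \<open>A maximum independent set \<open>S\<close> dominates, so its neighbourhood is its complement; taking unions over
  \<open>\<Lambda>\<close> gives \<open>N(\<Union>\<Lambda>) = V - \<Inter>\<Lambda>\<close>. For the inequality add the members of \<open>\<Lambda>\<close> one at a time: with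
  \<open>I = \<Inter>\<Lambda>\<close> and \<open>U = \<Union>\<Lambda>\<close>, a new maximum independent set \<open>S\<close> satisfies
  \<open>|I - S| \<le> |S \<inter> N(I - S)| \<le> |S - U|\<close>, the first step by exchanging \<open>S \<inter> N(I - S)\<close> for \<open>I - S\<close> in \<open>S\<close>,
  the second because every vertex of \<open>U\<close> lies in an independent set containing \<open>I\<close>.\<close>

lemma nbhd_Union: "nbhd G (\<Union>\<Lambda>) = (\<Union>S\<in>\<Lambda>. nbhd G S)"
  by (auto simp: nbhd_def)

lemma independent_set_empty: "independent_set G {}"
  by (simp add: independent_set_def)

lemma max_independent_sets_subset_verts: "S \<in> max_independent_sets G \<Longrightarrow> S \<subseteq> verts G"
  by (simp add: max_independent_sets_def independent_set_def)

context fin_digraph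
begin

lemma finite_independent_set: "independent_set G S \<Longrightarrow> finite S"
  by (auto simp: independent_set_def intro: finite_subset[OF _ finite_verts])

lemma finite_max_independent_sets: "finite (max_independent_sets G)"
  by (rule finite_subset[of _ "Pow (verts G)"])
    (auto dest: max_independent_sets_subset_verts)

lemma finite_independent_set_cards: "finite {card S | S. independent_set G S}"
proof -
  have "{card S | S. independent_set G S} \<subseteq> card ` Pow (verts G)"
    by (auto simp: independent_set_def)
  then show ?thesis
    by (rule finite_subset) simp
qed

lemma card_le_independence_number:
  "independent_set G S \<Longrightarrow> card S \<le> independence_number G"
  unfolding independence_number_def by (rule Max_ge[OF finite_independent_set_cards]) auto

text \<open>The empty set is independent, so the maximum defining \<open>independence_number\<close>
  ranges over a nonempty finite set and is attained.\<close>

lemma max_independent_sets_nonempty: "max_independent_sets G \<noteq> {}"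
proof -
  have "{card S | S. independent_set G S} \<noteq> {}"
    using independent_set_empty by blast
  from Max_in[OF finite_independent_set_cards this] show ?thesis
    by (auto simp: max_independent_sets_def independence_number_def)
qed

end

context graph
begin

text \<open>A vertex outside \<open>S\<close> without a neighbour in \<open>S\<close> could be added
  to \<open>S\<close>, giving a larger independent set.\<close>

lemma nbhd_max_independent_set:
  assumes "S \<in> max_independent_sets G"
  shows "nbhd G S = verts G - S"
proof (intro subset_antisym subsetI)
  fix v assume "v \<in> nbhd G S"
  then show "v \<in> verts G - S"
    using assms by (auto simp: nbhd_def max_independent_sets_def independent_set_def)
next
  fix v assume v: "v \<in> verts G - S"
  have S: "independent_set G S" "card S = independence_number G"
    using assms by (auto simp: max_independent_sets_def)
  show "v \<in> nbhd G S"
  proof (rule ccontr)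
    assume "v \<notin> nbhd G S"
    then have "\<forall>x\<in>S. \<not> x \<rightarrow> v"
      using v by (auto simp: nbhd_def)
    \<comment> \<open>\<open>independent_set\<close> also compares a vertex with itself, so absence
      of loops enters here.\<close>
    moreover have "\<not> v \<rightarrow> v"
      using adj_not_same by blast
    ultimately have "independent_set G (insert v S)"
      using S v unfolding independent_set_def
      by (auto dest: arcs_ends_symmetric[OF sym_arcs])
    from card_le_independence_number[OF this] show False
      using S v finite_independent_set by simp
  qed
qed

lemma diff_max_independent_set:
  assumes "S \<in> max_independent_sets G"
  shows "diff G S = 2 * int (independence_number G) - int (card (verts G))"
proof -
  have "S \<subseteq> verts G" "card S = independence_number G"
    using assms by (auto simp: max_independent_sets_def independent_set_def)
  then show ?thesis
    unfolding diff_def nbhd_max_independent_set[OF assms]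
    using card_mono[OF finite_verts, of S]
    by (simp add: card_Diff_subset finite_subset[OF _ finite_verts] of_nat_diff)
qed

text \<open>By De Morgan, the union of the complements of the members is the complement of
  \<open>\<Inter>\<Lambda>\<close>.\<close>

lemma diff_Union_max_independent_sets:
  assumes "\<Lambda> \<subseteq> max_independent_sets G" "\<Lambda> \<noteq> {}"
  shows "diff G (\<Union>\<Lambda>) = int (card (\<Inter>\<Lambda>)) + int (card (\<Union>\<Lambda>)) - int (card (verts G))"
proof -
  have "nbhd G (\<Union>\<Lambda>) = (\<Union>S\<in>\<Lambda>. verts G - S)"
    unfolding nbhd_Union using assms by (intro SUP_cong) (auto simp: nbhd_max_independent_set)
  also have "\<dots> = verts G - \<Inter>\<Lambda>"
    using assms by blast
  finally have "nbhd G (\<Union>\<Lambda>) = verts G - \<Inter>\<Lambda>" .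
  moreover have "\<Inter>\<Lambda> \<subseteq> verts G"
    using assms max_independent_sets_subset_verts by blast
  ultimately show ?thesis
    unfolding diff_def using card_mono[OF finite_verts, of "\<Inter>\<Lambda>"]
    by (simp add: card_Diff_subset finite_subset[OF _ finite_verts] of_nat_diff)
qed

text \<open>Exchange: dropping from \<open>S\<close> the neighbours of \<open>X\<close> and adding
  \<open>X\<close> keeps independence, so by maximality of \<open>S\<close> at least
  \<open>card X\<close> vertices were dropped.\<close>

lemma card_le_card_Int_nbhd:
  assumes S: "S \<in> max_independent_sets G" and X: "independent_set G X" "X \<inter> S = {}"
  shows "card X \<le> card (S \<inter> nbhd G X)"
proof -
  have ind: "independent_set G S" and card: "card S = independence_number G"
    using S by (auto simp: max_independent_sets_def)
  have fin: "finite S" "finite X"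
    using ind X by (auto intro: finite_independent_set)
  \<comment> \<open>\<open>nbhd\<close> only excludes arcs from \<open>X\<close> to
    \<open>S - nbhd G X\<close>; symmetry excludes those in the other direction.\<close>
  have "independent_set G ((S - nbhd G X) \<union> X)"
    using ind X unfolding independent_set_def nbhd_def
    by (auto dest: arcs_ends_symmetric[OF sym_arcs])
  then have "card ((S - nbhd G X) \<union> X) \<le> card S"
    unfolding card by (rule card_le_independence_number)
  moreover have "card ((S - nbhd G X) \<union> X) = card (S - nbhd G X) + card X"
    using fin X by (intro card_Un_disjoint) auto
  moreover have "card S = card (S - nbhd G X) + card (S \<inter> nbhd G X)"
    using fin card_Int_Diff[of S "nbhd G X"] by simp
  ultimately show ?thesis by simp
qed

text \<open>Adding \<open>S\<close> to \<Lambda> costs the intersection the vertices of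
  \<open>\<Inter>\<Lambda> - S\<close> and gains the union those of
  \<open>S - \<Union>\<Lambda>\<close>, so it suffices to compare these two sets.\<close>

lemma card_Inter_Union_insert:
  assumes \<Lambda>: "\<Lambda> \<subseteq> max_independent_sets G" "\<Lambda> \<noteq> {}" and S: "S \<in> max_independent_sets G"
  shows "card (\<Inter>\<Lambda>) + card (\<Union>\<Lambda>) \<le> card (S \<inter> \<Inter>\<Lambda>) + card (S \<union> \<Union>\<Lambda>)"
proof -
  let ?I = "\<Inter>\<Lambda>" and ?U = "\<Union>\<Lambda>"
  have ind: "independent_set G T" if "T \<in> \<Lambda>" for T
    using that \<Lambda> by (auto simp: max_independent_sets_def)
  have fin: "finite ?I" "finite ?U" "finite S"
    using \<Lambda> S max_independent_sets_subset_verts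
    by (blast intro: finite_subset[OF _ finite_verts])+
  have "independent_set G (?I - S)"
    using ind \<Lambda>(2) unfolding independent_set_def by blast
  then have "card (?I - S) \<le> card (S \<inter> nbhd G (?I - S))"
    by (intro card_le_card_Int_nbhd[OF S]) auto
  \<comment> \<open>A vertex of \<open>?U\<close> lies in some member of \<Lambda>; that member is
    independent and contains \<open>?I - S\<close>, so the vertex is not in
    \<open>nbhd G (?I - S)\<close>.\<close>
  also have "\<dots> \<le> card (S - ?U)"
    using fin ind by (intro card_mono) (auto simp: nbhd_def independent_set_def)
  finally have "card (?I - S) \<le> card (S - ?U)" .
  moreover have "card ?I = card (S \<inter> ?I) + card (?I - S)"
    using fin card_Int_Diff[of ?I S] by (simp add: Int_commute)
  moreover have "card (S \<union> ?U) = card (S - ?U) + card ?U"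
    using fin card_Un_disjoint[of "S - ?U" ?U] by auto
  ultimately show ?thesis by simp
qed

text \<open>For a single set, intersection and union coincide and equality holds; each further
  member does not decrease the sum.\<close>

lemma card_Inter_Union_ge:
  assumes "finite \<Lambda>" "\<Lambda> \<noteq> {}" "\<Lambda> \<subseteq> max_independent_sets G"
  shows "2 * independence_number G \<le> card (\<Inter>\<Lambda>) + card (\<Union>\<Lambda>)"
  using assms
proof (induction \<Lambda> rule: finite_ne_induct)
  case (singleton S)
  then show ?case by (simp add: max_independent_sets_def)
next
  case (insert S \<Lambda>)
  then show ?case using card_Inter_Union_insert[of \<Lambda> S] by simp
qed

text \<open>All maximum independent sets have the same value of \<open>diff\<close>, so the image is
  a singleton.\<close>

lemma Max_diff_max_independent_sets:
  assumes "\<Lambda> \<subseteq> max_independent_sets G" "\<Lambda> \<noteq> {}"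
  shows "Max (diff G ` \<Lambda>) = 2 * int (independence_number G) - int (card (verts G))"
proof -
  have "diff G ` \<Lambda> = {2 * int (independence_number G) - int (card (verts G))}"
    using assms diff_max_independent_set by force
  then show ?thesis by simp
qed

end

theorem theorem3p1:
  fixes G :: "('a, 'b) pre_digraph"
  assumes "graph G"
  shows "(\<forall>\<Lambda>. \<Lambda> \<subseteq> max_independent_sets G \<and> card \<Lambda> \<ge> 1 \<longrightarrow>
            diff G (\<Union>\<Lambda>) = int (card (\<Inter>\<Lambda>)) + int (card (\<Union>\<Lambda>)) - int (card (verts G)) \<and>
            int (card (\<Inter>\<Lambda>)) + int (card (\<Union>\<Lambda>)) - int (card (verts G)) \<ge> Max (diff G ` \<Lambda>)) \<and>
         diff G (corona G) = int (card (corona G)) + int (card (core G)) - int (card (verts G)) \<and>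
         int (card (corona G)) + int (card (core G)) - int (card (verts G))
           \<ge> 2 * int (independence_number G) - int (card (verts G)) \<and>
         2 * int (independence_number G) - int (card (verts G)) = Max (diff G ` max_independent_sets G)"
proof -
  interpret graph G by fact
  let ?\<Omega> = "max_independent_sets G"
  \<comment> \<open>The finiteness of \<Lambda> that the induction requires is inherited from the
    whole family \<open>?\<Omega>\<close>.\<close>
  have ge: "2 * int (independence_number G) \<le> int (card (\<Inter>\<Lambda>)) + int (card (\<Union>\<Lambda>))"
    if "\<Lambda> \<subseteq> ?\<Omega>" "\<Lambda> \<noteq> {}" for \<Lambda>
    using card_Inter_Union_ge[OF finite_subset[OF that(1) finite_max_independent_sets] that(2,1)]
    by linarith
  have "\<Lambda> \<noteq> {}" if "card \<Lambda> \<ge> 1" for \<Lambda> :: "'a set set"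
    using that by auto
  \<comment> \<open>The claims on \<open>core\<close> and \<open>corona\<close> are the case where
    \<Lambda> is all of \<open>?\<Omega>\<close>.\<close>
  then show ?thesis
    using ge diff_Union_max_independent_sets Max_diff_max_independent_sets
      ge[OF subset_refl max_independent_sets_nonempty]
      diff_Union_max_independent_sets[OF subset_refl max_independent_sets_nonempty]
      Max_diff_max_independent_sets[OF subset_refl max_independent_sets_nonempty]
    by (simp add: core_def corona_def)
qed

end
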